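(* Let $d\in\mathbb{N}$, $\sigma>0$, and let $X_1,X_2$ be i.i.d. random vectors in $\mathbb{R}^d$, independent of $\tilde Z_1,\tilde Z_2$, which are i.i.d. with law $\mathcal Q$ on $\mathbb{R}^d$. Assume $\mathcal Q$ is absolutely continuous with density $q$, and (true matching equal to the identity) $Y_j=X_j+\sigma\tilde Z_j$ for $j=1,2$. Set $W_{i,j}^{\mathcal Q,\sigma}=\log\left(q\left(\frac{Y_j-X_i}{\sigma}\right)\right)$ for $i,j\in\{1,2\}$. Then $$\mathbb{P}\left(W^{\mathcal Q,\sigma}_{1,2}+W^{\mathcal Q,\sigma}_{2,1}>W^{\mathcal Q,\sigma}_{1,1}+W^{\mathcal Q,\sigma}_{2,2}\right)\le\mathbb{P}\left(\|X_1-Y_2\|_2^2+\|X_2-Y_1\|_2^2<\|X_1-Y_1\|_2^2+\|X_2-Y_2\|_2^2\right).$$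
   Context: Convention: $\log 0=-\infty$. *)

theory Defs
  imports "HOL-Probability.Probability"
begin

(* The library's real logarithm has ln 0 = 0; here log 0 is -\<infinity>. *)
definition elog :: "real \<Rightarrow> ereal" where
  "elog x = (if x = 0 then -\<infinity> else ereal (ln x))"

(* The log-likelihood weight of matching X_i with Y_j.  Since q is finite-valued, no weight is
   +\<infinity>, so sums of weights never take the form \<infinity> + (-\<infinity>). *)
definition loglik_weight ::
  "(real ^ 'd \<Rightarrow> real) \<Rightarrow> real \<Rightarrow> (nat \<Rightarrow> 'w \<Rightarrow> real ^ 'd) \<Rightarrow> (nat \<Rightarrow> 'w \<Rightarrow> real ^ 'd)
     \<Rightarrow> nat \<Rightarrow> nat \<Rightarrow> 'w \<Rightarrow> ereal" where
  "loglik_weight q \<sigma> X Y i j \<omega> = elog (q ((Y j \<omega> - X i \<omega>) /\<^sub>R \<sigma>))"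

end

(* Given v = (X_1 - X_2) / \<sigma>, replacing the noises (z_1, z_2) of the true matching by those of
   the swapped one, T z = (z_2 - v, z_1 + v), is a measure-preserving involution of R^d x R^d.
   The maximum-likelihood matching errs when T raises the likelihood p(z) = q(z_1) q(z_2), the
   Euclidean one when T lowers the norm.  If v = 0, neither rule errs.  Otherwise, up to a null
   set, every orbit {z, T z} has exactly one point on which the Euclidean rule errs, whereas the
   likelihood rule errs at most at the point of smaller likelihood; hence it is optimal on every
   orbit, and one integrates over the law of (X_1, X_2). *)

theory Submission
  imports Defs
begin

text \<open>Thanks to log 0 = -\<infinity>, vanishing factors are no exception: both sides are then
  -\<infinity>, as no summand is +\<infinity>.\<close>

lemma elog_mult: "0 \<le> a \<Longrightarrow> 0 \<le> b \<Longrightarrow> elog (a * b) = elog a + elog b"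
  by (auto simp: elog_def ln_mult)

lemma elog_less_iff: "0 \<le> a \<Longrightarrow> 0 \<le> b \<Longrightarrow> elog a < elog b \<longleftrightarrow> a < b"
  by (auto simp: elog_def)

text \<open>Points of {p < p o T} inside \<open>A\<close> keep their mass. Almost every other such
  point \<open>x\<close> is charged to its partner \<open>T x\<close> in \<open>A\<close>, where the
  density is larger. A partner \<open>y\<close> satisfies \<open>p (T y) < p y\<close>, so no point
  of \<open>A\<close> is used twice.\<close>

lemma emeasure_density_involution_le:
  fixes p :: "'a \<Rightarrow> ennreal"
  assumes T[measurable]: "T \<in> N \<rightarrow>\<^sub>M N" and preserving: "distr N N T = N"
    and involution: "\<And>x. x \<in> space N \<Longrightarrow> T (T x) = x"
    and p[measurable]: "p \<in> borel_measurable N" and A[measurable]: "A \<in> sets N"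
    and swap: "AE x in N. x \<in> A \<or> T x \<in> A"
  shows "emeasure (density N p) {x \<in> space N. p x < p (T x)} \<le> emeasure (density N p) A"
proof -
  \<comment> \<open>\<open>g\<close> is the mass kept in \<open>A\<close>, \<open>f\<close> the mass
    received by a partner: \<open>f (T x)\<close> equals \<open>p x\<close> when \<open>T x\<close>
    lies in \<open>A\<close> and \<open>p x < p (T x)\<close>.\<close>
  define f where "f x = p (T x) * indicator A x * indicator {x \<in> space N. p (T x) < p x} x" for x
  define g where "g x = p x * indicator A x * indicator {x \<in> space N. p x < p (T x)} x" for x
  have [measurable]: "f \<in> borel_measurable N" "g \<in> borel_measurable N"
    unfolding f_def g_def by measurable
  have "emeasure (density N p) {x \<in> space N. p x < p (T x)}
      = (\<integral>\<^sup>+x. p x * indicator {x \<in> space N. p x < p (T x)} x \<partial>N)"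
    by (simp add: emeasure_density)
  also have "\<dots> \<le> (\<integral>\<^sup>+x. g x + f (T x) \<partial>N)"
  proof (rule nn_integral_mono_AE)
    show "AE x in N. p x * indicator {x \<in> space N. p x < p (T x)} x \<le> g x + f (T x)"
      using swap AE_space
    proof eventually_elim
      case (elim x)
      moreover have "T x \<in> space N"
        using elim by (intro measurable_space[OF T]) auto
      ultimately show ?case
        by (auto simp: f_def g_def involution indicator_def)
    qed
  qed
  also have "\<dots> = (\<integral>\<^sup>+x. g x \<partial>N) + (\<integral>\<^sup>+x. f (T x) \<partial>N)"
    by (rule nn_integral_add) auto
  also have "(\<integral>\<^sup>+x. f (T x) \<partial>N) = (\<integral>\<^sup>+x. f x \<partial>N)"
    using nn_integral_distr[of T N N f] preserving by simp
  also have "(\<integral>\<^sup>+x. g x \<partial>N) + (\<integral>\<^sup>+x. f x \<partial>N) = (\<integral>\<^sup>+x. g x + f x \<partial>N)"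
    by (rule nn_integral_add[symmetric]) auto
  \<comment> \<open>\<open>f\<close> and \<open>g\<close> have disjoint supports, and on the support
    of \<open>f\<close> the factor \<open>p (T x)\<close> is below \<open>p x\<close>.\<close>
  also have "\<dots> \<le> (\<integral>\<^sup>+x. p x * indicator A x \<partial>N)"
    by (rule nn_integral_mono) (auto simp: f_def g_def indicator_def)
  also have "\<dots> = emeasure (density N p) A"
    by (simp add: emeasure_density)
  finally show ?thesis .
qed

text \<open>For v = (X_1 - X_2) / \<sigma> the components are (Y_2 - X_1) / \<sigma> and (Y_1 - X_2)
  / \<sigma>. In the opposite order the map would be a translation instead of an involution.\<close>

definition noise_swap :: "'a::ab_group_add \<Rightarrow> 'a \<times> 'a \<Rightarrow> 'a \<times> 'a" where
  "noise_swap v z = (snd z - v, fst z + v)"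

lemma noise_swap_involution: "noise_swap v (noise_swap v z) = z"
  by (simp add: noise_swap_def)

lemma measurable_noise_swap [measurable]:
  fixes v :: "'b \<Rightarrow> 'a::euclidean_space"
  assumes [measurable]: "v \<in> N \<rightarrow>\<^sub>M borel" "z \<in> N \<rightarrow>\<^sub>M borel \<Otimes>\<^sub>M borel"
  shows "(\<lambda>x. noise_swap (v x) (z x)) \<in> N \<rightarrow>\<^sub>M borel \<Otimes>\<^sub>M borel"
  unfolding noise_swap_def by measurable

text \<open>The map exchanges the coordinates and then translates by \<open>(- v, v)\<close>; both
  operations preserve Lebesgue measure.\<close>

lemma distr_noise_swap:
  fixes v :: "'a::euclidean_space"
  shows "distr (lborel \<Otimes>\<^sub>M lborel) (lborel \<Otimes>\<^sub>M lborel) (noise_swap v)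
    = (lborel \<Otimes>\<^sub>M lborel :: ('a \<times> 'a) measure)" (is "distr ?L ?L _ = _")
proof -
  have "noise_swap v = (+) (- v, v) \<circ> (\<lambda>(x, y). (y, x))"
    by (auto simp: noise_swap_def fun_eq_iff)
  moreover have "(+) (- v, v) \<in> ?L \<rightarrow>\<^sub>M ?L"
    by (simp add: lborel_prod)
  moreover have "distr ?L ?L ((+) (- v, v)) = ?L"
    using lborel_distr_plus[of "(- v, v)"] unfolding lborel_prod
    by (metis distr_cong sets_lborel)
  ultimately show ?thesis
    using distr_distr[of "(+) (- v, v)" ?L ?L "\<lambda>(x, y). (y, x)" ?L] lborel_pair.distr_pair_swap
    by (metis measurable_pair_swap')
qed

text \<open>The squared norms differ by twice \<open>(v, - v) \<bullet> z + v \<bullet> v\<close>,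
  so ties form an affine hyperplane with nonzero normal \<open>(v, - v)\<close>.\<close>

lemma AE_norm_noise_swap_neq:
  fixes v :: "'a::euclidean_space"
  assumes "v \<noteq> 0"
  shows "AE z in lborel \<Otimes>\<^sub>M lborel. norm (noise_swap v z) \<noteq> norm z"
proof -
  let ?H = "{z. (v, - v) \<bullet> z = - (v \<bullet> v)}"
  have "?H \<in> null_sets lebesgue"
    using negligible_hyperplane[of "(v, - v)" "- (v \<bullet> v)"] assms
    by (simp add: negligible_iff_null_sets)
  \<comment> \<open>Negligibility concerns the completed measure; the hyperplane is closed, hence
    Borel, so it is also null for \<open>lborel\<close>.\<close>
  then have "?H \<in> null_sets lborel"
    by (subst (asm) null_sets_completion_iff) (auto intro!: borel_closed closed_hyperplane)
  moreover have "z \<in> ?H" if "norm (noise_swap v z) = norm z" for z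
    using that
    by (auto simp: noise_swap_def norm_Pair norm_prod_def real_sqrt_eq_iff power2_norm_eq_inner
      inner_prod_def inner_diff_left inner_diff_right inner_add_left inner_add_right inner_commute)
  ultimately show ?thesis
    unfolding lborel_prod by (auto intro: AE_I')
qed

lemma emeasure_likelihood_swap_le:
  fixes v :: "'a::euclidean_space" and q :: "'a \<Rightarrow> real"
  assumes [measurable]: "q \<in> borel_measurable borel" and nonneg: "\<And>z. 0 \<le> q z"
  defines "p \<equiv> \<lambda>z. q (fst z) * q (snd z)"
  shows "emeasure (density (lborel \<Otimes>\<^sub>M lborel) (\<lambda>z. ennreal (p z))) {z. p z < p (noise_swap v z)}
    \<le> emeasure (density (lborel \<Otimes>\<^sub>M lborel) (\<lambda>z. ennreal (p z))) {z. norm (noise_swap v z) < norm z}"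
proof (cases "v = 0")
  case True
  \<comment> \<open>Here every \<open>z\<close> is a norm tie, so the involution bound does not
    apply; but \<open>p\<close> is symmetric and the left-hand set is empty.\<close>
  then have "p (noise_swap v z) = p z" for z
    by (simp add: p_def noise_swap_def mult.commute)
  then show ?thesis by simp
next
  case False
  let ?L = "lborel \<Otimes>\<^sub>M lborel :: ('a \<times> 'a) measure"
  have sp: "space ?L = UNIV"
    by (simp add: space_pair_measure)
  have p[measurable]: "p \<in> borel_measurable ?L"
    unfolding p_def by measurable
  have T: "noise_swap v \<in> ?L \<rightarrow>\<^sub>M ?L"
    using measurable_noise_swap[of "\<lambda>_. v" "borel \<Otimes>\<^sub>M borel" "\<lambda>z. z"] by (simp cong: measurable_cong_sets)
  then have "{z. norm (noise_swap v z) < norm z} \<in> sets ?L"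
    unfolding lborel_prod by simp
  \<comment> \<open>Away from ties, if the swap raises the norm at \<open>z\<close>, then it lowers
    it at the partner, whose image is \<open>z\<close> again.\<close>
  moreover have "AE z in ?L. z \<in> {z. norm (noise_swap v z) < norm z}
      \<or> noise_swap v z \<in> {z. norm (noise_swap v z) < norm z}"
    using AE_norm_noise_swap_neq[OF False] by eventually_elim (auto simp: noise_swap_involution)
  ultimately have "emeasure (density ?L (\<lambda>z. ennreal (p z)))
       {z \<in> space ?L. ennreal (p z) < ennreal (p (noise_swap v z))}
    \<le> emeasure (density ?L (\<lambda>z. ennreal (p z))) {z. norm (noise_swap v z) < norm z}"
    using T by (intro emeasure_density_involution_le distr_noise_swap noise_swap_involution) auto
  then show ?thesis
    by (simp add: sp p_def nonneg ennreal_less_iff)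
qed

theorem lemma1p11:
  fixes M :: "'w measure"
    and X Z Y :: "nat \<Rightarrow> 'w \<Rightarrow> real ^ 'd"
    and Q :: "(real ^ 'd) measure"
    and q :: "real ^ 'd \<Rightarrow> real"
    and \<sigma> :: real
    and W :: "nat \<Rightarrow> nat \<Rightarrow> 'w \<Rightarrow> ereal"
  assumes M: "prob_space M"
    and sigma: "\<sigma> > 0"
    and X_indep: "prob_space.indep_vars M (\<lambda>_. borel) X {1, 2}"
    and X_ident: "distr M borel (X 1) = distr M borel (X 2)"
    and Z_indep: "prob_space.indep_vars M (\<lambda>_. borel) Z {1, 2}"
    and Z_law: "\<And>j. j \<in> {1, 2} \<Longrightarrow> distr M borel (Z j) = Q"
    and XZ_indep: "prob_space.indep_var M
                     (borel \<Otimes>\<^sub>M borel) (\<lambda>\<omega>. (X 1 \<omega>, X 2 \<omega>))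
                     (borel \<Otimes>\<^sub>M borel) (\<lambda>\<omega>. (Z 1 \<omega>, Z 2 \<omega>))"
    and q_meas: "q \<in> borel_measurable borel"
    and q_nonneg: "\<And>z. 0 \<le> q z"
    and Q_density: "Q = density lborel (\<lambda>z. ennreal (q z))"
    and Y: "\<And>j \<omega>. j \<in> {1, 2} \<Longrightarrow> \<omega> \<in> space M \<Longrightarrow> Y j \<omega> = X j \<omega> + \<sigma> *\<^sub>R Z j \<omega>"
    and W: "W = loglik_weight q \<sigma> X Y"
  shows "\<P>(\<omega> in M. W 1 2 \<omega> + W 2 1 \<omega> > W 1 1 \<omega> + W 2 2 \<omega>)
       \<le> \<P>(\<omega> in M. (norm (X 1 \<omega> - Y 2 \<omega>))\<^sup>2 + (norm (X 2 \<omega> - Y 1 \<omega>))\<^sup>2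
                    < (norm (X 1 \<omega> - Y 1 \<omega>))\<^sup>2 + (norm (X 2 \<omega> - Y 2 \<omega>))\<^sup>2)"
proof -
  interpret prob_space M by (rule M)
  let ?B = "borel :: (real ^ 'd) measure"
  define p where "p z = q (fst z) * q (snd z)" for z
  define gap where "gap x = (fst x - snd x) /\<^sub>R \<sigma>" for x :: "(real ^ 'd) \<times> (real ^ 'd)"
  define XX where "XX \<omega> = (X 1 \<omega>, X 2 \<omega>)" for \<omega>
  define ZZ where "ZZ \<omega> = (Z 1 \<omega>, Z 2 \<omega>)" for \<omega>
  have [measurable]: "XX \<in> M \<rightarrow>\<^sub>M ?B \<Otimes>\<^sub>M ?B" "ZZ \<in> M \<rightarrow>\<^sub>M ?B \<Otimes>\<^sub>M ?B"
    using XZ_indep by (auto simp: XX_def[abs_def] ZZ_def[abs_def] dest: indep_var_rv1 indep_var_rv2)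
  have [measurable]: "q \<in> borel_measurable borel" by (rule q_meas)
  have [measurable]: "p \<in> borel_measurable (?B \<Otimes>\<^sub>M ?B)" "gap \<in> ?B \<Otimes>\<^sub>M ?B \<rightarrow>\<^sub>M ?B"
    unfolding p_def[abs_def] gap_def[abs_def] by measurable
  have Z_meas: "Z j \<in> M \<rightarrow>\<^sub>M ?B" if "j \<in> {1, 2}" for j
    using Z_indep that by (auto simp: indep_vars_def2)
  define PX where "PX = distr M (?B \<Otimes>\<^sub>M ?B) XX"
  define PZ where "PZ = distr M (?B \<Otimes>\<^sub>M ?B) ZZ"
  interpret PZ: prob_space PZ
    unfolding PZ_def by (rule prob_space_distr) simp
  have sets_P[measurable_cong]: "sets PX = sets (?B \<Otimes>\<^sub>M ?B)" "sets PZ = sets (?B \<Otimes>\<^sub>M ?B)"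
    by (simp_all add: PX_def PZ_def)
  have joint: "distr M ((?B \<Otimes>\<^sub>M ?B) \<Otimes>\<^sub>M (?B \<Otimes>\<^sub>M ?B)) (\<lambda>\<omega>. (XX \<omega>, ZZ \<omega>)) = PX \<Otimes>\<^sub>M PZ"
    using XZ_indep unfolding PX_def PZ_def XX_def[abs_def] ZZ_def[abs_def]
    by (simp add: indep_var_distribution_eq)
  have "indep_var borel (Z 1) borel (Z 2)"
  proof -
    \<comment> \<open>Restricting the independent family to the disjoint index sets {1} and {2}
      gives independence of the pair.\<close>
    have "indep_var (?B) (\<lambda>\<omega>. restrict (\<lambda>i. Z i \<omega>) {1} 1) (?B) (\<lambda>\<omega>. restrict (\<lambda>i. Z i \<omega>) {2} 2)"
      using indep_var_compose[OF indep_var_restrict[OF Z_indep, of "{1}" "{2}"],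
        of "\<lambda>f. f 1" ?B "\<lambda>f. f 2" ?B] by (simp add: comp_def)
    then show ?thesis by simp
  qed
  then have "PZ = Q \<Otimes>\<^sub>M Q"
    using Z_law[of 1] Z_law[of 2] unfolding PZ_def ZZ_def[abs_def]
    by (simp add: indep_var_distribution_eq)
  also have "\<dots> = density (lborel \<Otimes>\<^sub>M lborel) (\<lambda>z. ennreal (p z))"
  proof -
    have "prob_space Q"
      using prob_space_distr[OF Z_meas[of 1]] Z_law[of 1] by simp
    then have "sigma_finite_measure Q"
      by (rule prob_space_imp_sigma_finite)
    then show ?thesis
      unfolding Q_density
      by (subst pair_measure_density)
        (auto simp: p_def ennreal_mult q_nonneg case_prod_beta' lborel.sigma_finite_measure_axioms)
  qed
  finally have PZ_eq: "PZ = density (lborel \<Otimes>\<^sub>M lborel) (\<lambda>z. ennreal (p z))" .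

  \<comment> \<open>Independence makes the joint law a product, so Tonelli applies; a section of
    \<open>E\<close> consists of the noises that lead to \<open>E\<close> for given positions
    \<open>x\<close>.\<close>
  have total: "emeasure M {\<omega> \<in> space M. (XX \<omega>, ZZ \<omega>) \<in> E}
      = (\<integral>\<^sup>+x. emeasure PZ (Pair x -` E) \<partial>PX)"
    if E: "E \<in> sets ((?B \<Otimes>\<^sub>M ?B) \<Otimes>\<^sub>M (?B \<Otimes>\<^sub>M ?B))" for E
  proof -
    have "emeasure M {\<omega> \<in> space M. (XX \<omega>, ZZ \<omega>) \<in> E} = emeasure (PX \<Otimes>\<^sub>M PZ) E"
      unfolding joint[symmetric] using E
      by (subst emeasure_distr) (auto intro!: arg_cong[where f = "emeasure M"])
    also have "\<dots> = (\<integral>\<^sup>+x. emeasure PZ (Pair x -` E) \<partial>PX)"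
      using E by (intro PZ.emeasure_pair_measure_alt) (simp add: sets_P cong: sets_pair_measure_cong)
    finally show ?thesis .
  qed

  define E1 where "E1 = {(x, z). p z < p (noise_swap (gap x) z)}"
  define E2 where "E2 = {(x, z). norm (noise_swap (gap x) z) < norm z}"
  have sp: "space ((?B \<Otimes>\<^sub>M ?B) \<Otimes>\<^sub>M (?B \<Otimes>\<^sub>M ?B)) = UNIV"
    by (simp add: space_pair_measure)
  have E_sets: "E1 \<in> sets ((?B \<Otimes>\<^sub>M ?B) \<Otimes>\<^sub>M (?B \<Otimes>\<^sub>M ?B))"
      "E2 \<in> sets ((?B \<Otimes>\<^sub>M ?B) \<Otimes>\<^sub>M (?B \<Otimes>\<^sub>M ?B))"
  proof -
    have "{w \<in> space ((?B \<Otimes>\<^sub>M ?B) \<Otimes>\<^sub>M (?B \<Otimes>\<^sub>M ?B)). p (snd w) < p (noise_swap (gap (fst w)) (snd w))}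
        \<in> sets ((?B \<Otimes>\<^sub>M ?B) \<Otimes>\<^sub>M (?B \<Otimes>\<^sub>M ?B))"
      by measurable
    then show "E1 \<in> sets ((?B \<Otimes>\<^sub>M ?B) \<Otimes>\<^sub>M (?B \<Otimes>\<^sub>M ?B))"
      by (simp add: E1_def sp case_prod_beta')
    have "{w \<in> space ((?B \<Otimes>\<^sub>M ?B) \<Otimes>\<^sub>M (?B \<Otimes>\<^sub>M ?B)). norm (noise_swap (gap (fst w)) (snd w)) < norm (snd w)}
        \<in> sets ((?B \<Otimes>\<^sub>M ?B) \<Otimes>\<^sub>M (?B \<Otimes>\<^sub>M ?B))"
      \<comment> \<open>Writing the norm through its components gives measurability for the product
        sigma-algebra.\<close>
      unfolding norm_prod_def by measurable
    then show "E2 \<in> sets ((?B \<Otimes>\<^sub>M ?B) \<Otimes>\<^sub>M (?B \<Otimes>\<^sub>M ?B))"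
      by (simp add: E2_def sp case_prod_beta')
  qed
  have "emeasure M {\<omega> \<in> space M. (XX \<omega>, ZZ \<omega>) \<in> E1} \<le> emeasure M {\<omega> \<in> space M. (XX \<omega>, ZZ \<omega>) \<in> E2}"
    unfolding total[OF E_sets(1)] total[OF E_sets(2)]
  \<comment> \<open>The bound holds conditionally on every pair of positions, with shift
    \<open>gap x\<close>.\<close>
  proof (rule nn_integral_mono)
    fix x
    show "emeasure PZ (Pair x -` E1) \<le> emeasure PZ (Pair x -` E2)"
      using emeasure_likelihood_swap_le[OF q_meas q_nonneg, of "gap x"]
      by (simp add: PZ_eq E1_def E2_def p_def vimage_def)
  qed
  then have le: "prob {\<omega> \<in> space M. (XX \<omega>, ZZ \<omega>) \<in> E1} \<le> prob {\<omega> \<in> space M. (XX \<omega>, ZZ \<omega>) \<in> E2}"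
    by (simp add: emeasure_eq_measure)

  have YX: "Y 1 \<omega> - X 1 \<omega> = \<sigma> *\<^sub>R Z 1 \<omega>" "Y 2 \<omega> - X 2 \<omega> = \<sigma> *\<^sub>R Z 2 \<omega>"
      "Y 2 \<omega> - X 1 \<omega> = \<sigma> *\<^sub>R fst (noise_swap (gap (XX \<omega>)) (ZZ \<omega>))"
      "Y 1 \<omega> - X 2 \<omega> = \<sigma> *\<^sub>R snd (noise_swap (gap (XX \<omega>)) (ZZ \<omega>))"
    if "\<omega> \<in> space M" for \<omega>
    using that sigma by (simp_all add: Y noise_swap_def gap_def XX_def ZZ_def algebra_simps)
  \<comment> \<open>Dividing by \<sigma> leaves exactly the true and the swapped noises; strict
    monotonicity of \<open>elog\<close>, including at 0, turns the sums of weights into values of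
    \<open>p\<close>.\<close>
  have "W 1 1 \<omega> + W 2 2 \<omega> < W 1 2 \<omega> + W 2 1 \<omega> \<longleftrightarrow> (XX \<omega>, ZZ \<omega>) \<in> E1" if "\<omega> \<in> space M" for \<omega>
    using sigma q_nonneg
    by (simp add: W loglik_weight_def YX[OF that] E1_def p_def ZZ_def
      elog_mult[symmetric] elog_less_iff del: One_nat_def)
  \<comment> \<open>The common factor \<sigma>^2 > 0 cancels, leaving the squared norms of the two
    noise pairs.\<close>
  moreover have "(norm (X 1 \<omega> - Y 2 \<omega>))\<^sup>2 + (norm (X 2 \<omega> - Y 1 \<omega>))\<^sup>2
        < (norm (X 1 \<omega> - Y 1 \<omega>))\<^sup>2 + (norm (X 2 \<omega> - Y 2 \<omega>))\<^sup>2 \<longleftrightarrow> (XX \<omega>, ZZ \<omega>) \<in> E2"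
    if "\<omega> \<in> space M" for \<omega>
    using sigma
    by (simp add: norm_minus_commute[of "X _ _"] YX[OF that] E2_def norm_prod_def ZZ_def
      power_mult_distrib distrib_left[symmetric] del: One_nat_def)
  ultimately show ?thesis
    using le by (simp cong: conj_cong)
qed

end
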